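(* Let $T$ be a tree on $n$ vertices. If $n\ge 4$, then $$\mathcal{P}(T) > \frac{9}{16}\qquad\text{and}\qquad \mathcal{Q}(T)\ge \frac{9}{16}-\frac{5}{16n},$$ where $\mathcal{P}$, $\mathcal{Q}$ are the winning probabilities of an optimal player moving first, respectively second, in the tree search game against a uniformly random opponent.
   Context: A tree is a connected acyclic undirected graph with a finite, positive number of vertices; $|T|$ is the number of vertices of $T$; $T\smallsetminus v$ is the forest obtained by deleting $v$ and its incident edges. Tree search game on $T$: one vertex of $T$ is selected uniformly at random as the target, unknown to both players. The players alternately guess vertices. If the guess $v$ is the target, the player who made it wins. Otherwise both players are informed which component of $T\smallsetminus v$ contains the target, and the game continues on that component with the other player to move. Here one player plays to maximize their probability of winning, while the opponent always guesses a vertex uniformly at random from among the vertices that could still be the target. $\mathcal{P}(T)$ (resp. $\mathcal{Q}(T)$) is the probability that the optimal player wins when the optimal player moves first (resp. second) on $T$. Equivalently, with $n=|T|$, they are determined recursively by $$\mathcal{P}(T)=\max_{v\in V(T)}\Bigl(\frac1n+\frac1n\sum_{T'}|T'|\,\mathcal{Q}(T')\Bigr),\qquad \mathcal{Q}(T)=\frac1{n^2}\sum_{v\in V(T)}\sum_{T'}|T'|\,\mathcal{P}(T'),$$ where $T'$ ranges over the components of $T\smallsetminus v$ (empty sums are $0$). *)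

theory Defs
  imports "HOL-Probability.Probability"
begin

text \<open>
  A graph is given by a vertex set \<open>V\<close> and a set \<open>E\<close> of edges, each edge being a two-element
  set of vertices.
\<close>

definition simple_graph :: "'a set \<Rightarrow> 'a set set \<Rightarrow> bool" where
  "simple_graph V E \<longleftrightarrow> (\<forall>e\<in>E. e \<subseteq> V \<and> card e = 2)"

text \<open>Adjacency in the subgraph of \<open>E\<close> induced on the vertex set \<open>W\<close>.\<close>

definition adj_on :: "'a set set \<Rightarrow> 'a set \<Rightarrow> ('a \<times> 'a) set" where
  "adj_on E W = {(u, w). u \<in> W \<and> w \<in> W \<and> {u, w} \<in> E}"

text \<open>The vertex set of the component containing \<open>u\<close> of that induced subgraph (for \<open>u \<in> W\<close>).\<close>

definition component_of :: "'a set set \<Rightarrow> 'a set \<Rightarrow> 'a \<Rightarrow> 'a set" where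
  "component_of E W u = {w. (u, w) \<in> (adj_on E W)\<^sup>*}"

definition graph_components :: "'a set set \<Rightarrow> 'a set \<Rightarrow> 'a set set" where
  "graph_components E W = component_of E W ` W"

definition connected_graph :: "'a set \<Rightarrow> 'a set set \<Rightarrow> bool" where
  "connected_graph V E \<longleftrightarrow> (\<forall>u\<in>V. \<forall>w\<in>V. (u, w) \<in> (adj_on E V)\<^sup>*)"

definition graph_cycle :: "'a set set \<Rightarrow> 'a list \<Rightarrow> bool" where
  "graph_cycle E p \<longleftrightarrow> 3 \<le> length p \<and> distinct p \<and>
     (\<forall>i<length p. {p ! i, p ! (Suc i mod length p)} \<in> E)"

definition tree :: "'a set \<Rightarrow> 'a set set \<Rightarrow> bool" where
  "tree V E \<longleftrightarrow> finite V \<and> V \<noteq> {} \<and> simple_graph V E \<and> connected_graph V E \<and>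
     (\<nexists>p. graph_cycle E p)"

text \<open>
  A strategy of the optimal player prescribes a guess for every set of vertices that could still
  be the target. This set determines the position, since the random opponent has no memory.
\<close>

definition strategies :: "('a set \<Rightarrow> 'a) set" where
  "strategies = {\<sigma>. \<forall>W. W \<noteq> {} \<longrightarrow> \<sigma> W \<in> W}"

text \<open>
  The game with target \<open>t\<close>, continued from the set \<open>V\<close> of possible targets; \<open>opt\<close> says whether
  the strategic player (playing \<open>\<sigma>\<close>) or the uniformly random opponent moves next. The outcome
  \<open>True\<close> means that the strategic player wins. The guards \<open>finite V \<and> t \<in> V\<close> and \<open>v \<in> V\<close>
  only serve termination: they hold throughout any play from a finite \<open>V\<close> with \<open>t \<in> V\<close> and
  \<open>\<sigma> \<in> strategies\<close>.
\<close>

function play :: "'a set set \<Rightarrow> ('a set \<Rightarrow> 'a) \<Rightarrow> bool \<Rightarrow> 'a \<Rightarrow> 'a set \<Rightarrow> bool pmf" where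
  "play E \<sigma> opt t V =
     (if finite V \<and> t \<in> V then
        do {
          v \<leftarrow> (if opt then return_pmf (\<sigma> V) else pmf_of_set V);
          if v = t then return_pmf opt
          else if v \<in> V then play E \<sigma> (\<not> opt) t (component_of E (V - {v}) t)
          else return_pmf False
        }
      else return_pmf False)"
  by pat_completeness auto

lemma component_of_subset: "t \<in> W \<Longrightarrow> component_of E W t \<subseteq> W"
proof
  fix x assume t: "t \<in> W" and "x \<in> component_of E W t"
  then have "(t, x) \<in> (adj_on E W)\<^sup>*" by (simp add: component_of_def)
  then show "x \<in> W"
  proof (cases rule: rtranclE)
    case base
    then show ?thesis using t by simp
  next
    case (step y)
    then show ?thesis by (simp add: adj_on_def)
  qed
qed

termination play
proof (relation "Wellfounded.measure (\<lambda>(E, \<sigma>, opt, t, V). card V)", goal_cases)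
  case 1 show ?case by simp
next
  case (2 E \<sigma> opt t V v)
  then have fin: "finite V" and t: "t \<in> V - {v}" and v: "v \<in> V" by blast+
  have "component_of E (V - {v}) t \<subset> V" using component_of_subset[OF t, of E] v by blast
  then have "card (component_of E (V - {v}) t) < card V" using fin by (rule psubset_card_mono[rotated])
  then show ?case by simp
qed

declare play.simps [simp del]

text \<open>The winning probability of the player using \<open>\<sigma>\<close>, for a uniformly random target.\<close>

definition win_prob :: "'a set \<Rightarrow> 'a set set \<Rightarrow> bool \<Rightarrow> ('a set \<Rightarrow> 'a) \<Rightarrow> real" where
  "win_prob V E opt \<sigma> = measure_pmf.prob (do {t \<leftarrow> pmf_of_set V; play E \<sigma> opt t V}) {True}"

text \<open>The winning probability of an optimal player who moves first, respectively second.\<close>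

definition P_first :: "'a set \<Rightarrow> 'a set set \<Rightarrow> real" where
  "P_first V E = (SUP \<sigma>\<in>strategies. win_prob V E True \<sigma>)"

definition Q_second :: "'a set \<Rightarrow> 'a set set \<Rightarrow> real" where
  "Q_second V E = (SUP \<sigma>\<in>strategies. win_prob V E False \<sigma>)"

subsection \<open>The recursive characterization holds for these winning probabilities\<close>

lemma component_of_self: "t \<in> component_of E W t"
  by (simp add: component_of_def)

lemma graph_components_subset: "C \<in> graph_components E W \<Longrightarrow> C \<subseteq> W"
  unfolding graph_components_def by (erule imageE) (simp add: component_of_subset)

lemma graph_components_nonempty: "C \<in> graph_components E W \<Longrightarrow> C \<noteq> {}"
  unfolding graph_components_def by (erule imageE) (metis component_of_self empty_iff)

lemma component_of_eq:
  assumes "x \<in> component_of E W t"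
  shows "component_of E W x = component_of E W t"
proof -
  have "sym (adj_on E W)"
    unfolding sym_def adj_on_def by (simp add: insert_commute)
  then have "sym ((adj_on E W)\<^sup>*)" by (rule sym_rtrancl)
  moreover have tx: "(t, x) \<in> (adj_on E W)\<^sup>*"
    using assms by (simp add: component_of_def)
  ultimately have xt: "(x, t) \<in> (adj_on E W)\<^sup>*" by (rule symD)
  show ?thesis unfolding component_of_def
    using rtrancl_trans[OF tx] rtrancl_trans[OF xt] by blast
qed

lemma sum_components:
  fixes f :: "'a set \<Rightarrow> 'a \<Rightarrow> real"
  assumes "finite W"
  shows "(\<Sum>t\<in>W. f (component_of E W t) t) = (\<Sum>C\<in>graph_components E W. \<Sum>t\<in>C. f C t)"
proof -
  have eq: "{x \<in> W. component_of E W x = C} = C" if C: "C \<in> graph_components E W" for C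
  proof
    show "{x \<in> W. component_of E W x = C} \<subseteq> C"
      using component_of_self by (metis (mono_tags, lifting) mem_Collect_eq subsetI)
    show "C \<subseteq> {x \<in> W. component_of E W x = C}"
    proof
      fix x assume x: "x \<in> C"
      obtain t where "C = component_of E W t" using C by (auto simp: graph_components_def)
      then have "component_of E W x = C" using x component_of_eq by metis
      then show "x \<in> {x \<in> W. component_of E W x = C}" using x graph_components_subset[OF C] by blast
    qed
  qed
  have "(\<Sum>t\<in>W. f (component_of E W t) t) =
      (\<Sum>C\<in>graph_components E W. \<Sum>t\<in>{x \<in> W. component_of E W x = C}. f (component_of E W t) t)"
    using assms by (intro sum.group[symmetric]) (auto simp: graph_components_def)
  also have "\<dots> = (\<Sum>C\<in>graph_components E W. \<Sum>t\<in>{x \<in> W. component_of E W x = C}. f C t)"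
    by (intro sum.cong) auto
  also have "\<dots> = (\<Sum>C\<in>graph_components E W. \<Sum>t\<in>C. f C t)"
    by (intro sum.cong eq refl)
  finally show ?thesis .
qed

definition win_sum :: "'a set set \<Rightarrow> ('a set \<Rightarrow> 'a) \<Rightarrow> bool \<Rightarrow> 'a set \<Rightarrow> real" where
  "win_sum E \<sigma> opt V = (\<Sum>t\<in>V. pmf (play E \<sigma> opt t V) True)"

lemma win_prob_eq:
  assumes "finite V" "V \<noteq> {}"
  shows "win_prob V E opt \<sigma> = win_sum E \<sigma> opt V / real (card V)"
  using assms by (simp add: win_prob_def win_sum_def measure_pmf_single pmf_bind_pmf_of_set)

lemma win_sum_step:
  assumes "finite V" "v \<in> V"
  shows "(\<Sum>t\<in>V. pmf (if v = t then return_pmf opt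
            else if v \<in> V then play E \<sigma> (\<not> opt) t (component_of E (V - {v}) t)
            else return_pmf False) True) =
         of_bool opt + (\<Sum>C\<in>graph_components E (V - {v}). win_sum E \<sigma> (\<not> opt) C)"
    (is "(\<Sum>t\<in>V. ?g t) = _")
proof -
  have "(\<Sum>t\<in>V. ?g t) = ?g v + (\<Sum>t\<in>V - {v}. ?g t)"
    using assms by (rule sum.remove)
  also have "?g v = of_bool opt"
    by (simp add: pmf_return)
  also have "(\<Sum>t\<in>V - {v}. ?g t) =
      (\<Sum>t\<in>V - {v}. pmf (play E \<sigma> (\<not> opt) t (component_of E (V - {v}) t)) True)"
  proof (rule sum.cong[OF refl])
    fix t assume "t \<in> V - {v}"
    then have "v \<noteq> t" by blast
    then show "?g t = pmf (play E \<sigma> (\<not> opt) t (component_of E (V - {v}) t)) True"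
      using assms(2) by (simp only: if_True if_False)
  qed
  also have "\<dots> = (\<Sum>C\<in>graph_components E (V - {v}). win_sum E \<sigma> (\<not> opt) C)"
    unfolding win_sum_def using assms(1) by (intro sum_components) simp
  finally show ?thesis .
qed

lemma win_sum_True:
  assumes "finite V" "V \<noteq> {}" "\<sigma> \<in> strategies"
  shows "win_sum E \<sigma> True V = 1 + (\<Sum>C\<in>graph_components E (V - {\<sigma> V}). win_sum E \<sigma> False C)"
proof -
  have "\<sigma> V \<in> V" using assms by (auto simp: strategies_def)
  from win_sum_step[OF assms(1) this, of True E \<sigma>] show ?thesis
    using assms(1) by (subst win_sum_def) (simp add: play.simps[of _ _ _ _ V] bind_return_pmf)
qed

lemma win_sum_False:
  assumes "finite V" "V \<noteq> {}"
  shows "win_sum E \<sigma> False V =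
    (\<Sum>v\<in>V. \<Sum>C\<in>graph_components E (V - {v}). win_sum E \<sigma> True C) / real (card V)"
proof -
  let ?g = "\<lambda>v t. pmf (if v = t then return_pmf False
            else if v \<in> V then play E \<sigma> (\<not> False) t (component_of E (V - {v}) t)
            else return_pmf False) True"
  have "win_sum E \<sigma> False V = (\<Sum>t\<in>V. (\<Sum>v\<in>V. ?g v t) / real (card V))"
    unfolding win_sum_def using assms
    by (intro sum.cong refl) (simp add: play.simps[of _ _ _ _ V] pmf_bind_pmf_of_set)
  also have "\<dots> = (\<Sum>v\<in>V. \<Sum>t\<in>V. ?g v t) / real (card V)"
    by (subst sum.swap) (simp add: sum_divide_distrib)
  also have "(\<Sum>v\<in>V. \<Sum>t\<in>V. ?g v t) = (\<Sum>v\<in>V. \<Sum>C\<in>graph_components E (V - {v}). win_sum E \<sigma> True C)"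
    using win_sum_step[OF assms(1), of _ False E \<sigma>] by (intro sum.cong) auto
  finally show ?thesis .
qed

function opt_sum :: "'a set set \<Rightarrow> bool \<Rightarrow> 'a set \<Rightarrow> real" where
  "opt_sum E opt V =
     (if finite V then
        if opt then Max ((\<lambda>v. 1 + (\<Sum>C\<in>graph_components E (V - {v}). opt_sum E False C)) ` V)
        else (\<Sum>v\<in>V. \<Sum>C\<in>graph_components E (V - {v}). opt_sum E True C) / real (card V)
      else 0)"
  by pat_completeness auto
termination
proof (relation "Wellfounded.measure (\<lambda>(E, opt, V). card V)", goal_cases)
  case 1 show ?case by simp
next
  case (2 E opt V v C)
  then have fin: "finite V" and v: "v \<in> V" and C: "C \<in> graph_components E (V - {v})" by blast+
  have "C \<subset> V" using graph_components_subset[OF C] v by blast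
  then have "card C < card V" using fin by (rule psubset_card_mono[rotated])
  then show ?case by simp
next
  case (3 E opt V v C)
  then have fin: "finite V" and v: "v \<in> V" and C: "C \<in> graph_components E (V - {v})" by blast+
  have "C \<subset> V" using graph_components_subset[OF C] v by blast
  then have "card C < card V" using fin by (rule psubset_card_mono[rotated])
  then show ?case by simp
qed

declare opt_sum.simps [simp del]

lemma win_sum_le_opt_sum:
  assumes "finite V" "V \<noteq> {}" "\<sigma> \<in> strategies"
  shows "win_sum E \<sigma> opt V \<le> opt_sum E opt V"
  using assms(1,2)
proof (induction "card V" arbitrary: V opt rule: less_induct)
  case less
  have IH: "win_sum E \<sigma> b C \<le> opt_sum E b C" if "v \<in> V" "C \<in> graph_components E (V - {v})" for v C b
  proof -
    have "C \<subset> V" using that graph_components_subset[of C E "V - {v}"] by blast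
    then show ?thesis using less that graph_components_nonempty
      by (metis finite_subset psubset_card_mono psubset_imp_subset)
  qed
  show ?case
  proof (cases opt)
    case True
    have v: "\<sigma> V \<in> V" using assms less by (auto simp: strategies_def)
    have "win_sum E \<sigma> True V \<le> 1 + (\<Sum>C\<in>graph_components E (V - {\<sigma> V}). opt_sum E False C)"
      using win_sum_True[OF less.prems assms(3), of E] sum_mono[OF IH[OF v]] by fastforce
    also have "\<dots> \<le> opt_sum E True V"
      using less.prems v by (subst (2) opt_sum.simps) (auto intro!: Max_ge)
    finally show ?thesis using True by simp
  next
    case False
    have "(\<Sum>v\<in>V. \<Sum>C\<in>graph_components E (V - {v}). win_sum E \<sigma> True C) \<le>
        (\<Sum>v\<in>V. \<Sum>C\<in>graph_components E (V - {v}). opt_sum E True C)"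
      by (intro sum_mono IH)
    then show ?thesis
      using False less.prems win_sum_False[OF less.prems, of E \<sigma>]
      by (subst opt_sum.simps) (simp add: divide_right_mono)
  qed
qed

lemma optimal_strategy_exists:
  obtains \<sigma> where "\<sigma> \<in> strategies"
    "\<And>V opt. finite V \<Longrightarrow> V \<noteq> {} \<Longrightarrow> win_sum E \<sigma> opt V = opt_sum E opt V"
proof -
  let ?f = "\<lambda>V v. 1 + (\<Sum>C\<in>graph_components E (V - {v}). opt_sum E False C)"
  have "\<exists>v. v \<in> V \<and> (finite V \<longrightarrow> ?f V v = Max (?f V ` V))" if "V \<noteq> {}" for V
  proof (cases "finite V")
    case True
    then have "Max (?f V ` V) \<in> ?f V ` V" using that by (intro Max_in) auto
    then obtain v where "v \<in> V" "Max (?f V ` V) = ?f V v" by blast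
    then show ?thesis by metis
  next
    case False
    then show ?thesis using that by auto
  qed
  then obtain \<sigma> where \<sigma>: "\<And>V. V \<noteq> {} \<Longrightarrow> \<sigma> V \<in> V"
      "\<And>V. V \<noteq> {} \<Longrightarrow> finite V \<Longrightarrow> ?f V (\<sigma> V) = Max (?f V ` V)"
    by metis
  have strat: "\<sigma> \<in> strategies" using \<sigma> by (auto simp: strategies_def)
  have "win_sum E \<sigma> opt V = opt_sum E opt V" if "finite V" "V \<noteq> {}" for V opt
    using that
  proof (induction "card V" arbitrary: V opt rule: less_induct)
    case less
    have IH: "win_sum E \<sigma> b C = opt_sum E b C" if "v \<in> V" "C \<in> graph_components E (V - {v})" for v C b
    proof -
      have "C \<subset> V" using that graph_components_subset[of C E "V - {v}"] by blast
      then show ?thesis using less that graph_components_nonempty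
        by (metis finite_subset psubset_card_mono psubset_imp_subset)
    qed
    show ?case
    proof (cases opt)
      case True
      have "win_sum E \<sigma> True V = ?f V (\<sigma> V)"
        using win_sum_True[OF less.prems strat, of E] sum.cong[OF refl IH[OF \<sigma>(1)]] less.prems
        by simp
      also have "\<dots> = opt_sum E True V"
        using \<sigma>(2) less.prems by (subst (2) opt_sum.simps) simp
      finally show ?thesis using True by simp
    next
      case False
      then show ?thesis using IH win_sum_False[OF less.prems, of E \<sigma>] less.prems
        by (subst opt_sum.simps) simp
    qed
  qed
  then show ?thesis using that strat by blast
qed

lemma SUP_win_prob:
  assumes "finite V" "V \<noteq> {}"
  shows "(SUP \<sigma>\<in>strategies. win_prob V E opt \<sigma>) = opt_sum E opt V / real (card V)"
proof -
  obtain \<sigma> where \<sigma>: "\<sigma> \<in> strategies" "win_sum E \<sigma> opt V = opt_sum E opt V"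
    using optimal_strategy_exists assms by metis
  show ?thesis
  proof (rule cSup_eq_maximum)
    show "opt_sum E opt V / real (card V) \<in> win_prob V E opt ` strategies"
      using \<sigma> win_prob_eq[OF assms, of E opt \<sigma>] by (metis image_eqI)
    show "x \<le> opt_sum E opt V / real (card V)" if "x \<in> win_prob V E opt ` strategies" for x
      using that assms
      by (auto simp: win_prob_eq intro!: divide_right_mono win_sum_le_opt_sum)
  qed
qed

lemma opt_sum_eq:
  assumes "finite V" "V \<noteq> {}"
  shows "opt_sum E True V = real (card V) * P_first V E"
    and "opt_sum E False V = real (card V) * Q_second V E"
  using assms SUP_win_prob[OF assms] by (simp_all add: P_first_def Q_second_def)

theorem P_first_rec:
  assumes "finite V" "V \<noteq> {}"
  shows "P_first V E = (MAX v\<in>V. 1 / real (card V) +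
     1 / real (card V) * (\<Sum>C\<in>graph_components E (V - {v}). real (card C) * Q_second C E))"
proof -
  have *: "(\<Sum>C\<in>graph_components E (V - {v}). real (card C) * Q_second C E) =
      (\<Sum>C\<in>graph_components E (V - {v}). opt_sum E False C)" for v
  proof (intro sum.cong refl)
    fix C assume C: "C \<in> graph_components E (V - {v})"
    then have "finite C" using assms graph_components_subset by (metis finite_Diff finite_subset)
    then show "real (card C) * Q_second C E = opt_sum E False C"
      using opt_sum_eq(2) graph_components_nonempty[OF C] by metis
  qed
  have mono: "mono (\<lambda>x. x / real (card V))" by (simp add: mono_def divide_right_mono)
  have "P_first V E = Max ((\<lambda>v. 1 + (\<Sum>C\<in>graph_components E (V - {v}). opt_sum E False C)) ` V)
      / real (card V)"
    using assms opt_sum_eq(1)[OF assms, of E] opt_sum.simps[of E True V] by simp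
  also have "\<dots> = (MAX v\<in>V. (1 + (\<Sum>C\<in>graph_components E (V - {v}). opt_sum E False C)) / real (card V))"
    using assms by (subst mono_Max_commute[OF mono]) (auto simp: image_image)
  finally show ?thesis by (simp add: * add_divide_distrib)
qed

theorem Q_second_rec:
  assumes "finite V" "V \<noteq> {}"
  shows "Q_second V E = 1 / (real (card V))\<^sup>2 *
     (\<Sum>v\<in>V. \<Sum>C\<in>graph_components E (V - {v}). real (card C) * P_first C E)"
proof -
  have *: "(\<Sum>C\<in>graph_components E (V - {v}). real (card C) * P_first C E) =
      (\<Sum>C\<in>graph_components E (V - {v}). opt_sum E True C)" for v
  proof (intro sum.cong refl)
    fix C assume C: "C \<in> graph_components E (V - {v})"
    then have "finite C" using assms graph_components_subset by (metis finite_Diff finite_subset)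
    then show "real (card C) * P_first C E = opt_sum E True C"
      using opt_sum_eq(1) graph_components_nonempty[OF C] by metis
  qed
  show ?thesis
    unfolding * using assms opt_sum_eq(2)[OF assms, of E] opt_sum.simps[of E False V]
    by (simp add: power2_eq_square field_simps)
qed

end

theory Submission
  imports Defs
begin

text \<open>
  Let \<open>p A\<close> and \<open>q A\<close> be the winning probabilities on a subtree \<open>A\<close> with \<open>n\<close> vertices, multiplied
  by \<open>n\<close> (these are \<open>opt_sum E True A\<close> and \<open>opt_sum E False A\<close>). By induction on \<open>n\<close>, both
  \<open>16 p A \<ge> 9 n + 2 + excess n\<close> and \<open>16 q A \<ge> 9 n - 5 + excess (n + 1)\<close> hold for every subtree,
  where \<open>excess\<close> corrects for the irregular small sizes and vanishes from \<open>6\<close> on.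

  For the player moving first it suffices to guess a leaf: if the guess is wrong, one component
  of size \<open>n - 1\<close> remains, so \<open>16 p \<ge> 16 + 9 (n - 1) - 5 + excess n = 9 n + 2 + excess n\<close>
  (\<open>first_player_step\<close>, using \<open>leaf_exists\<close>).

  For the player moving second, \<open>n q A\<close> is the sum of \<open>p C\<close> over all components \<open>C\<close> that a guess in
  \<open>A\<close> can leave. Each edge produces two of these, its two sides, of sizes \<open>s\<close> and \<open>n - s\<close>. The
  linear parts of the bounds on \<open>16 p\<close> add up to \<open>(9 n + 4) (n - 1) = 9 n\<^sup>2 - 5 n - 4\<close>, so the
  claim is that the sum of \<open>excess s + excess (n - s)\<close> over all edges is at least
  \<open>4 + n * excess (n + 1)\<close>. Sides of size \<open>2\<close> and \<open>4\<close> contribute negatively, but they contain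
  leaves, which contribute positively. Sizes alone control this balance: once the tree is
  rooted, a branch of size \<open>s\<close> consists of its root and of smaller branches with \<open>s - 1\<close> vertices
  together, so any subadditive \<open>b\<close> with \<open>b 0 = 0\<close> and
  \<open>b s \<le> excess s + excess (n - s) + b (s - 1)\<close> bounds the sum over the edges in and above such a
  branch from below, and the sum over the whole tree is at least \<open>b (n - 1)\<close>
  (\<open>component_sum_lower_bound\<close>). It remains to find such a \<open>b\<close> with a large value at \<open>n - 1\<close>
  (\<open>edge_bound_exists\<close>).
\<close>

section \<open>Components of connected subgraphs\<close>

lemma adj_on_rtrancl_sym: "(x, y) \<in> (adj_on E W)\<^sup>* \<Longrightarrow> (y, x) \<in> (adj_on E W)\<^sup>*"
proof -
  have "sym (adj_on E W)"
    unfolding sym_def adj_on_def by (simp add: insert_commute)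
  then have "sym ((adj_on E W)\<^sup>*)" by (rule sym_rtrancl)
  then show "(x, y) \<in> (adj_on E W)\<^sup>* \<Longrightarrow> (y, x) \<in> (adj_on E W)\<^sup>*"
    by (rule symD)
qed

lemma adj_on_rtrancl_mono: "(x, y) \<in> (adj_on E W)\<^sup>* \<Longrightarrow> W \<subseteq> X \<Longrightarrow> (x, y) \<in> (adj_on E X)\<^sup>*"
proof -
  assume xy: "(x, y) \<in> (adj_on E W)\<^sup>*" and "W \<subseteq> X"
  then have "adj_on E W \<subseteq> adj_on E X" by (auto simp: adj_on_def)
  from subsetD[OF rtrancl_mono[OF this] xy] show "(x, y) \<in> (adj_on E X)\<^sup>*" .
qed

lemma connected_graphI:
  assumes "\<And>x. x \<in> W \<Longrightarrow> (t, x) \<in> (adj_on E W)\<^sup>*"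
  shows "connected_graph W E"
  unfolding connected_graph_def
proof (intro ballI)
  fix x y assume "x \<in> W" "y \<in> W"
  then show "(x, y) \<in> (adj_on E W)\<^sup>*"
    using rtrancl_trans[OF adj_on_rtrancl_sym[OF assms] assms] by simp
qed

lemma connected_graphD:
  "connected_graph W E \<Longrightarrow> x \<in> W \<Longrightarrow> y \<in> W \<Longrightarrow> (x, y) \<in> (adj_on E W)\<^sup>*"
  by (simp add: connected_graph_def)

lemma connected_graph_Un:
  assumes X: "connected_graph X E" and Y: "connected_graph Y E"
    and x: "x \<in> X" and y: "y \<in> Y" and xy: "{x, y} \<in> E"
  shows "connected_graph (X \<union> Y) E"
proof (rule connected_graphI[where t = x])
  fix z assume "z \<in> X \<union> Y"
  then show "(x, z) \<in> (adj_on E (X \<union> Y))\<^sup>*"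
  proof
    assume "z \<in> X"
    then show ?thesis by (rule adj_on_rtrancl_mono[OF connected_graphD[OF X x] Un_upper1])
  next
    assume "z \<in> Y"
    then have "(y, z) \<in> (adj_on E (X \<union> Y))\<^sup>*"
      by (rule adj_on_rtrancl_mono[OF connected_graphD[OF Y y] Un_upper2])
    moreover have "(x, y) \<in> adj_on E (X \<union> Y)"
      using x y xy by (simp add: adj_on_def)
    ultimately show ?thesis by (rule converse_rtrancl_into_rtrancl[rotated])
  qed
qed

lemma component_of_connected: "connected_graph (component_of E W t) E"
proof (rule connected_graphI[where t = t])
  fix x assume "x \<in> component_of E W t"
  then have "(t, x) \<in> (adj_on E W)\<^sup>*" by (simp add: component_of_def)
  then show "(t, x) \<in> (adj_on E (component_of E W t))\<^sup>*"
  proof (induction rule: rtrancl_induct)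
    case base
    show ?case by simp
  next
    case (step y z)
    have "z \<in> component_of E W t" "y \<in> component_of E W t"
      using step.hyps rtrancl_into_rtrancl[OF step.hyps] by (simp_all add: component_of_def)
    then have "(y, z) \<in> adj_on E (component_of E W t)"
      using step.hyps(2) by (simp add: adj_on_def)
    with step.IH show ?case by (rule rtrancl_into_rtrancl)
  qed
qed

lemma component_of_closed:
  assumes "t \<in> W" "x \<in> component_of E W t" "y \<in> W" "{x, y} \<in> E"
  shows "y \<in> component_of E W t"
proof -
  have "x \<in> W" using component_of_subset[OF assms(1)] assms(2) by (rule subsetD)
  then have "(x, y) \<in> adj_on E W" using assms by (simp add: adj_on_def)
  with assms(2) show ?thesis unfolding component_of_def mem_Collect_eq
    by (rule rtrancl_into_rtrancl)
qed

lemma component_of_eqI: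
  assumes "t \<in> K" "K \<subseteq> W" "connected_graph K E"
    and closed: "\<And>x y. x \<in> K \<Longrightarrow> y \<in> W - K \<Longrightarrow> {x, y} \<notin> E"
  shows "component_of E W t = K"
proof
  show "component_of E W t \<subseteq> K"
  proof
    fix x assume "x \<in> component_of E W t"
    then have "(t, x) \<in> (adj_on E W)\<^sup>*" by (simp add: component_of_def)
    then show "x \<in> K"
    proof (induction rule: rtrancl_induct)
      case base
      show ?case by (rule assms(1))
    next
      case (step y z)
      then show ?case using closed[of y z] by (auto simp: adj_on_def)
    qed
  qed
  show "K \<subseteq> component_of E W t"
  proof
    fix x assume "x \<in> K"
    then have "(t, x) \<in> (adj_on E W)\<^sup>*"
      by (rule adj_on_rtrancl_mono[OF connected_graphD[OF assms(3,1)] assms(2)])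
    then show "x \<in> component_of E W t" by (simp add: component_of_def)
  qed
qed

lemma graph_components_eqI:
  assumes "\<Union>\<K> = W" and ne: "{} \<notin> \<K>"
    and conn: "\<And>K. K \<in> \<K> \<Longrightarrow> connected_graph K E"
    and closed: "\<And>K x y. K \<in> \<K> \<Longrightarrow> x \<in> K \<Longrightarrow> y \<in> W - K \<Longrightarrow> {x, y} \<notin> E"
  shows "graph_components E W = \<K>"
proof -
  have eq: "component_of E W t = K" if "K \<in> \<K>" "t \<in> K" for K t
    using that(2) _ conn[OF that(1)] closed[OF that(1)]
    by (rule component_of_eqI) (use assms(1) that(1) in blast)
  show ?thesis
  proof
    show "graph_components E W \<subseteq> \<K>"
      unfolding graph_components_def
    proof (rule image_subsetI)
      fix t assume "t \<in> W"
      then obtain K where "K \<in> \<K>" "t \<in> K" using assms(1) by blast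
      then show "component_of E W t \<in> \<K>" using eq by simp
    qed
    show "\<K> \<subseteq> graph_components E W"
    proof
      fix K assume K: "K \<in> \<K>"
      then obtain t where t: "t \<in> K" using ne by (metis ex_in_conv)
      then have "t \<in> W" using K assms(1) by blast
      then show "K \<in> graph_components E W"
        unfolding graph_components_def using eq[OF K t, symmetric] by (rule image_eqI[rotated])
    qed
  qed
qed

lemma graph_componentsD:
  assumes "K \<in> graph_components E W"
  shows "connected_graph K E"
    and "x \<in> K \<Longrightarrow> y \<in> W - K \<Longrightarrow> {x, y} \<notin> E"
    and "x \<in> K \<Longrightarrow> component_of E W x = K"
proof -
  obtain t where t: "t \<in> W" "K = component_of E W t"
    using assms by (auto simp: graph_components_def)
  show "connected_graph K E" unfolding t(2) by (rule component_of_connected)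
  show "x \<in> K \<Longrightarrow> y \<in> W - K \<Longrightarrow> {x, y} \<notin> E"
    unfolding t(2) using component_of_closed[OF t(1), of x E y] by blast
  show "x \<in> K \<Longrightarrow> component_of E W x = K"
    unfolding t(2) by (rule component_of_eq)
qed

lemma Union_graph_components: "\<Union>(graph_components E W) = W"
proof
  show "\<Union>(graph_components E W) \<subseteq> W"
    using graph_components_subset by (rule Union_least)
  show "W \<subseteq> \<Union>(graph_components E W)"
    unfolding graph_components_def using component_of_self[of _ E W] by blast
qed

lemma finite_graph_components: "finite W \<Longrightarrow> finite (graph_components E W)"
  by (simp add: graph_components_def)

lemma sum_card_components:
  assumes "finite W"
  shows "(\<Sum>C\<in>graph_components E W. card C) = card W"
proof -
  have "real (card W) = (\<Sum>C\<in>graph_components E W. real (card C))"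
    using sum_components[OF assms, of "\<lambda>_ _. 1" E] by simp
  then show ?thesis by (metis of_nat_eq_iff of_nat_sum)
qed

text \<open>
  Loops are cut off a walk when they arise: if the new endpoint has been visited before, the
  walk is shortened to its first visit.
\<close>

lemma rtrancl_distinct_path:
  assumes "(x, y) \<in> r\<^sup>*"
  shows "\<exists>p. p \<noteq> [] \<and> hd p = x \<and> last p = y \<and> distinct p \<and> successively (\<lambda>a b. (a, b) \<in> r) p"
  using assms
proof (induction rule: rtrancl_induct)
  case base
  show ?case by (rule exI[of _ "[x]"]) simp
next
  case (step y z)
  then obtain p where p: "p \<noteq> []" "hd p = x" "last p = y" "distinct p"
    "successively (\<lambda>a b. (a, b) \<in> r) p" by blast
  show ?case
  proof (cases "z \<in> set p")
    case True
    then obtain as bs where "p = as @ z # bs" by (meson split_list)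
    then have "p = (as @ [z]) @ bs" by simp
    with p show ?thesis
      by (intro exI[of _ "as @ [z]"]) (auto simp: successively_append_iff hd_append)
  next
    case False
    with p step.hyps show ?thesis
      by (intro exI[of _ "p @ [z]"]) (auto simp: successively_append_iff)
  qed
qed

section \<open>Branches of a subtree\<close>

locale acyclic_graph =
  fixes E :: "'a set set"
  assumes no_cycle: "\<nexists>p. graph_cycle E p"
begin

definition subtree :: "'a set \<Rightarrow> bool" where
  "subtree A \<longleftrightarrow> finite A \<and> A \<noteq> {} \<and> connected_graph A E"

lemma component_subtree:
  assumes "finite W" "C \<in> graph_components E W"
  shows "subtree C"
  unfolding subtree_def
  using finite_subset[OF graph_components_subset[OF assms(2)] assms(1)]
    graph_components_nonempty[OF assms(2)] graph_componentsD(1)[OF assms(2)]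
  by simp

lemma attachment_exists:
  assumes A: "subtree A" and u: "u \<in> A" and C: "C \<in> graph_components E (A - {u})"
  shows "\<exists>c\<in>C. {u, c} \<in> E"
proof (rule ccontr)
  assume none: "\<not> (\<exists>c\<in>C. {u, c} \<in> E)"
  obtain t where t: "t \<in> C" using graph_components_nonempty[OF C] by blast
  have sub: "C \<subseteq> A - {u}" using C by (rule graph_components_subset)
  have "component_of E A t = C"
  proof (rule component_of_eqI[OF t])
    show "C \<subseteq> A" using sub by blast
    show "connected_graph C E" using C by (rule graph_componentsD)
    show "{x, y} \<notin> E" if "x \<in> C" "y \<in> A - C" for x y
      using that none graph_componentsD(2)[OF C, of x y] by (cases "y = u") (auto simp: insert_commute)
  qed
  moreover have "u \<in> component_of E A t"
    using connected_graphD[of A E t u] A t sub u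
    unfolding subtree_def component_of_def by blast
  ultimately show False using sub by blast
qed

text \<open>
  Two neighbours of \<open>u\<close> in one component of the rest would close a cycle through \<open>u\<close>.
  Acyclicity enters through this fact only.
\<close>

lemma attachment_unique:
  assumes C: "connected_graph C E" and u: "u \<notin> C"
    and c: "c \<in> C" "{u, c} \<in> E" and d: "d \<in> C" "{u, d} \<in> E"
  shows "c = d"
proof (rule ccontr)
  assume "c \<noteq> d"
  have "(c, d) \<in> (adj_on E C)\<^sup>*" using connected_graphD[OF C] c d by blast
  then obtain p where p: "p \<noteq> []" "hd p = c" "last p = d" "distinct p"
    "successively (\<lambda>a b. (a, b) \<in> adj_on E C) p"
    using rtrancl_distinct_path by metis
  have len: "2 \<le> length p"
  proof (rule ccontr)
    assume "\<not> 2 \<le> length p"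
    then obtain x where "p = [x]" using p(1) by (cases p) (auto simp: Suc_le_eq)
    then show False using p \<open>c \<noteq> d\<close> by simp
  qed
  have nth: "(p ! i, p ! Suc i) \<in> adj_on E C" if "Suc i < length p" for i
    using p(5) that by (simp add: successively_conv_nth)
  have "set p \<subseteq> C"
  proof
    fix x assume "x \<in> set p"
    then obtain i where i: "i < length p" "x = p ! i" by (metis in_set_conv_nth)
    show "x \<in> C"
    proof (cases i)
      case 0
      then show ?thesis using i p c by (simp add: hd_conv_nth)
    next
      case (Suc j)
      then show ?thesis using nth[of j] i by (simp add: adj_on_def)
    qed
  qed
  then have "u \<notin> set p" using u by blast
  have "graph_cycle E (u # p)"
    unfolding graph_cycle_def
  proof (intro conjI allI impI)
    show "3 \<le> length (u # p)" using len by simp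
    show "distinct (u # p)" using p(4) \<open>u \<notin> set p\<close> by simp
    fix i assume i: "i < length (u # p)"
    consider "i = 0" | j where "i = Suc j" "Suc j < length p" | "i = length p"
      using i by (cases i) (auto simp: less_Suc_eq)
    then show "{(u # p) ! i, (u # p) ! (Suc i mod length (u # p))} \<in> E"
    proof cases
      case 1
      then show ?thesis using p c by (simp add: hd_conv_nth)
    next
      case 2
      then show ?thesis using nth[of j] by (simp add: adj_on_def)
    next
      case 3
      have "(u # p) ! length p = d" using p by (simp add: last_conv_nth nth_Cons')
      then show ?thesis using 3 d by (simp add: insert_commute)
    qed
  qed
  then show False using no_cycle by blast
qed

definition branch :: "'a set \<Rightarrow> 'a \<Rightarrow> 'a set \<Rightarrow> 'a \<Rightarrow> bool" where
  "branch A u C c \<longleftrightarrow> subtree A \<and> u \<in> A \<and> C \<in> graph_components E (A - {u}) \<and> c \<in> C \<and> {u, c} \<in> E"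

lemma branch_exists:
  assumes "subtree A" "u \<in> A" "C \<in> graph_components E (A - {u})"
  obtains c where "branch A u C c"
  using assms attachment_exists[OF assms] unfolding branch_def by blast

lemma branch_subset: "branch A u C c \<Longrightarrow> C \<subseteq> A - {u}"
  unfolding branch_def by (elim conjE) (rule graph_components_subset)

lemma branch_only_edge:
  assumes br: "branch A u C c" and xy: "x \<in> C" "y \<in> A - C" "{x, y} \<in> E"
  shows "x = c \<and> y = u"
proof -
  have C: "C \<in> graph_components E (A - {u})" using br by (simp add: branch_def)
  have "y = u" using graph_componentsD(2)[OF C, of x y] xy by blast
  moreover have "x = c"
    using attachment_unique[OF graph_componentsD(1)[OF C], of u x c] branch_subset[OF br]
      xy br \<open>y = u\<close> by (auto simp: branch_def insert_commute)
  ultimately show ?thesis by simp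
qed

text \<open>
  Every vertex outside \<open>C\<close> other than \<open>u\<close> lies in another branch at \<open>u\<close>, and \<open>u\<close> is adjacent to
  that branch.
\<close>

lemma branch_rest_connected:
  assumes br: "branch A u C c"
  shows "connected_graph (A - C) E"
proof (rule connected_graphI[where t = u])
  have A: "subtree A" "u \<in> A" and C: "C \<in> graph_components E (A - {u})"
    using br by (auto simp: branch_def)
  fix x assume x: "x \<in> A - C"
  show "(u, x) \<in> (adj_on E (A - C))\<^sup>*"
  proof (cases "x = u")
    case False
    define D where "D = component_of E (A - {u}) x"
    have D: "D \<in> graph_components E (A - {u})"
      using x False by (auto simp: D_def graph_components_def)
    have xD: "x \<in> D" by (simp add: D_def component_of_self)
    obtain d where d: "d \<in> D" "{u, d} \<in> E" using attachment_exists[OF A D] by blast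
    have "D \<inter> C = {}"
      using graph_componentsD(3)[OF C] graph_componentsD(3)[OF D] x xD by blast
    then have sub: "D \<subseteq> A - C" using graph_components_subset[OF D] by blast
    have "(d, x) \<in> (adj_on E (A - C))\<^sup>*"
      using connected_graphD[OF graph_componentsD(1)[OF D] d(1) xD] sub by (rule adj_on_rtrancl_mono)
    moreover have "(u, d) \<in> adj_on E (A - C)"
      using d sub A branch_subset[OF br] by (auto simp: adj_on_def)
    ultimately show ?thesis by (rule converse_rtrancl_into_rtrancl[rotated])
  qed simp
qed

text \<open>
  The edge \<open>{u, c}\<close> is the only link between \<open>C\<close> and the connected set \<open>A - C\<close>. A guess inside \<open>C\<close>
  therefore leaves the components that it leaves in \<open>C\<close> alone, except that \<open>A - C\<close> is joined to
  the one containing \<open>c\<close>, or stands alone if \<open>c\<close> itself is guessed.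
\<close>

lemma components_remove_attachment:
  assumes br: "branch A u C c"
  shows "graph_components E (A - {c}) = insert (A - C) (graph_components E (C - {c}))"
proof (rule graph_components_eqI)
  note sub = branch_subset[OF br]
  have uc: "u \<in> A" "c \<in> C" using br by (auto simp: branch_def)
  show "\<Union> (insert (A - C) (graph_components E (C - {c}))) = A - {c}"
    using Union_graph_components[of E "C - {c}"] sub uc by auto
  show "{} \<notin> insert (A - C) (graph_components E (C - {c}))"
    using graph_components_nonempty[of "{}" E "C - {c}"] sub uc by blast
  show "connected_graph K E" if "K \<in> insert (A - C) (graph_components E (C - {c}))" for K
    using that branch_rest_connected[OF br] graph_componentsD(1)[of K E "C - {c}"] by blast
  fix K x y
  assume K: "K \<in> insert (A - C) (graph_components E (C - {c}))"
    and x: "x \<in> K" and y: "y \<in> A - {c} - K"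
  from K show "{x, y} \<notin> E"
  proof
    assume "K = A - C"
    then show ?thesis using x y branch_only_edge[OF br, of y x] by (auto simp: insert_commute)
  next
    assume K: "K \<in> graph_components E (C - {c})"
    then have "x \<in> C - {c}" using x graph_components_subset[OF K] by blast
    then show ?thesis
      using x y branch_only_edge[OF br, of x y] graph_componentsD(2)[OF K, of x y] by blast
  qed
qed

lemma components_remove_inner:
  assumes br: "branch A u C c" and w: "w \<in> C" "w \<noteq> c"
  defines "K \<equiv> component_of E (C - {w}) c"
  shows "graph_components E (A - {w}) =
    insert ((A - C) \<union> K) (graph_components E (C - {w}) - {K})"
proof (rule graph_components_eqI)
  note sub = branch_subset[OF br]
  have uc: "u \<in> A" "c \<in> C" "{u, c} \<in> E" using br by (auto simp: branch_def)
  have K: "K \<in> graph_components E (C - {w})" using w uc by (simp add: K_def graph_components_def)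
  have cK: "c \<in> K" by (simp add: K_def component_of_self)
  let ?\<K> = "insert ((A - C) \<union> K) (graph_components E (C - {w}) - {K})"
  show "\<Union> ?\<K> = A - {w}"
    using Union_graph_components[of E "C - {w}"] K sub w by auto
  show "{} \<notin> ?\<K>"
    using graph_components_nonempty[of "{}" E "C - {w}"] sub uc by blast
  show "connected_graph J E" if "J \<in> ?\<K>" for J
  proof -
    have "connected_graph ((A - C) \<union> K) E"
      using branch_rest_connected[OF br] graph_componentsD(1)[OF K] _ cK uc(3)
      by (rule connected_graph_Un) (use uc sub in blast)
    then show ?thesis using that graph_componentsD(1)[of J E "C - {w}"] by blast
  qed
  fix J x y
  assume J: "J \<in> ?\<K>" and x: "x \<in> J" and y: "y \<in> A - {w} - J"
  from J show "{x, y} \<notin> E"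
  proof
    assume "J = (A - C) \<union> K"
    then show ?thesis
      using x y branch_only_edge[OF br, of y x] graph_componentsD(2)[OF K, of x y] cK
      by (auto simp: insert_commute)
  next
    assume "J \<in> graph_components E (C - {w}) - {K}"
    then have J: "J \<in> graph_components E (C - {w})" "J \<noteq> K" by auto
    have "c \<notin> J" using graph_componentsD(3)[OF J(1), of c] J(2) by (auto simp: K_def)
    moreover have "x \<in> C - {w}" using x graph_components_subset[OF J(1)] by blast
    ultimately show ?thesis
      using x y branch_only_edge[OF br, of x y] graph_componentsD(2)[OF J(1), of x y] by blast
  qed
qed

text \<open>
  Among all branches at all vertices of \<open>A\<close>, a smallest one is a single vertex: removing the
  attachment vertex of a larger one would leave a still smaller branch inside it.
\<close>

lemma leaf_exists:
  assumes A: "subtree A" and "2 \<le> card A"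
  shows "\<exists>v\<in>A. graph_components E (A - {v}) = {A - {v}}"
proof -
  have finA: "finite A" using A by (simp add: subtree_def)
  define R where "R = {(u, C). u \<in> A \<and> C \<in> graph_components E (A - {u})}"
  obtain u where u: "u \<in> A" using A by (auto simp: subtree_def)
  have "card (A - {u}) = card A - 1" using u by (rule card_Diff_singleton)
  then have "A - {u} \<noteq> {}" using assms(2) by force
  then have "\<exists>z. z \<in> R" using u Union_graph_components[of E "A - {u}"] unfolding R_def by blast
  then obtain z where z: "z \<in> R" "\<And>z'. z' \<in> R \<Longrightarrow> card (snd z) \<le> card (snd z')"
    using ex_has_least_nat[of "\<lambda>z. z \<in> R" _ "\<lambda>z. card (snd z)"] by blast
  obtain u C where zC: "z = (u, C)" by (cases z)
  have uC: "u \<in> A" "C \<in> graph_components E (A - {u})" using z zC by (auto simp: R_def)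
  then obtain c where br: "branch A u C c" using branch_exists[OF A] by metis
  have finC: "finite C" using branch_subset[OF br] finA by (rule finite_subset[OF _ finite_Diff])
  have cC: "c \<in> C" using br by (simp add: branch_def)
  note comps = components_remove_attachment[OF br]
  have "C - {c} = {}"
  proof (rule ccontr)
    assume "C - {c} \<noteq> {}"
    then obtain D where D: "D \<in> graph_components E (C - {c})"
      using Union_graph_components[of E "C - {c}"] by blast
    have "(c, D) \<in> R" using D comps cC branch_subset[OF br] by (auto simp: R_def)
    then have "card C \<le> card D" using z(2) zC by fastforce
    moreover have "D \<subset> C" using graph_components_subset[OF D] cC by blast
    then have "card D < card C" using finC by (rule psubset_card_mono[rotated])
    ultimately show False by simp
  qed
  then have "C = {c}" using cC by blast
  then show ?thesis
    using comps cC branch_subset[OF br] by (auto simp: graph_components_def intro!: bexI[of _ c])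
qed

section \<open>Summing over all components left by one guess\<close>

text \<open>
  Here \<open>A\<close> stands for a branch, attached at \<open>u\<close>, of a tree with \<open>k\<close> further vertices. These lie
  on the far side of \<open>u\<close>, so they enlarge exactly the component that contains \<open>u\<close>. Carrying \<open>k\<close>
  along keeps the size \<open>card A + k\<close> of the whole tree fixed when passing to a branch of \<open>A\<close>.
\<close>

definition component_sum :: "(nat \<Rightarrow> real) \<Rightarrow> 'a set \<Rightarrow> 'a \<Rightarrow> nat \<Rightarrow> real" where
  "component_sum h A u k =
     (\<Sum>w\<in>A. \<Sum>D\<in>graph_components E (A - {w}). h (card D + (if u \<in> D then k else 0)))"

text \<open>
  The edge from \<open>u\<close> to \<open>C\<close> has two sides: \<open>C\<close> appears when \<open>u\<close> is guessed, and the other side,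
  with its \<open>card A - card C + k\<close> vertices, when \<open>c\<close> is guessed. Any other guess in \<open>C\<close> sees that
  side only as an enlargement of the component of \<open>c\<close>.
\<close>

lemma component_sum_branch:
  assumes br: "branch A u C c"
  shows "(\<Sum>w\<in>C. \<Sum>D\<in>graph_components E (A - {w}). h (card D + (if u \<in> D then k else 0))) =
    h (card A - card C + k) + component_sum h C c (card A - card C + k)"
proof -
  let ?k = "card A - card C + k"
  let ?g = "\<lambda>w. \<Sum>D\<in>graph_components E (A - {w}). h (card D + (if u \<in> D then k else 0))"
  let ?g' = "\<lambda>w. \<Sum>D\<in>graph_components E (C - {w}). h (card D + (if c \<in> D then ?k else 0))"
  note sub = branch_subset[OF br]
  have uc: "u \<in> A" "c \<in> C" and finA: "finite A" using br by (auto simp: branch_def subtree_def)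
  have finC: "finite C" using sub finA by (rule finite_subset[OF _ finite_Diff])
  have cardAC: "card (A - C) = card A - card C" using sub finC by (intro card_Diff_subset) auto
  have g_c: "?g c = h ?k + ?g' c"
  proof -
    have notin: "A - C \<notin> graph_components E (C - {c})"
      using graph_components_subset[of "A - C" E "C - {c}"] uc sub by blast
    have "?g c = h (card (A - C) + k) +
        (\<Sum>D\<in>graph_components E (C - {c}). h (card D + (if u \<in> D then k else 0)))"
      unfolding components_remove_attachment[OF br]
      using notin finC uc sub by (subst sum.insert) (auto simp: finite_graph_components)
    also have "(\<Sum>D\<in>graph_components E (C - {c}). h (card D + (if u \<in> D then k else 0))) = ?g' c"
    proof (intro sum.cong refl)
      fix D assume "D \<in> graph_components E (C - {c})"
      then have "D \<subseteq> C - {c}" by (rule graph_components_subset)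
      then have "u \<notin> D" "c \<notin> D" using sub by auto
      then show "h (card D + (if u \<in> D then k else 0)) = h (card D + (if c \<in> D then ?k else 0))"
        by simp
    qed
    finally show ?thesis by (simp add: cardAC)
  qed
  have g_w: "?g w = ?g' w" if w: "w \<in> C - {c}" for w
  proof -
    define K where "K = component_of E (C - {w}) c"
    have K: "K \<in> graph_components E (C - {w})" using w uc by (auto simp: K_def graph_components_def)
    have cK: "c \<in> K" by (simp add: K_def component_of_self)
    have Ksub: "K \<subseteq> C - {w}" using K by (rule graph_components_subset)
    have fin: "finite (graph_components E (C - {w}))" using finC by (simp add: finite_graph_components)
    have notin: "(A - C) \<union> K \<notin> graph_components E (C - {w}) - {K}"
      using graph_components_subset[of "(A - C) \<union> K" E "C - {w}"] uc sub by blast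
    have comps: "graph_components E (A - {w}) =
        insert ((A - C) \<union> K) (graph_components E (C - {w}) - {K})"
      using components_remove_inner[OF br, of w] w by (simp add: K_def)
    have "card ((A - C) \<union> K) = card A - card C + card K"
      using Ksub finA finC by (subst card_Un_disjoint) (auto simp: cardAC intro: finite_subset)
    moreover have "u \<in> (A - C) \<union> K" using uc sub by blast
    moreover have "?g w = h (card ((A - C) \<union> K) + (if u \<in> (A - C) \<union> K then k else 0)) +
        (\<Sum>D\<in>graph_components E (C - {w}) - {K}. h (card D + (if u \<in> D then k else 0)))"
      using notin fin unfolding comps by (subst sum.insert) auto
    moreover have "(\<Sum>D\<in>graph_components E (C - {w}) - {K}. h (card D + (if u \<in> D then k else 0))) =
        (\<Sum>D\<in>graph_components E (C - {w}) - {K}. h (card D + (if c \<in> D then ?k else 0)))"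
    proof (intro sum.cong refl)
      fix D assume D: "D \<in> graph_components E (C - {w}) - {K}"
      then have "u \<notin> D" using graph_components_subset[of D E "C - {w}"] sub by blast
      moreover have "c \<notin> D" using D graph_componentsD(3)[of D E "C - {w}" c] by (auto simp: K_def)
      ultimately show "h (card D + (if u \<in> D then k else 0)) = h (card D + (if c \<in> D then ?k else 0))"
        by simp
    qed
    moreover have "?g' w = h (card K + ?k) +
        (\<Sum>D\<in>graph_components E (C - {w}) - {K}. h (card D + (if c \<in> D then ?k else 0)))"
      using cK by (subst sum.remove[OF fin K]) simp
    ultimately show ?thesis by (simp add: algebra_simps)
  qed
  have "(\<Sum>w\<in>C. ?g w) = ?g c + (\<Sum>w\<in>C - {c}. ?g w)" using finC uc by (intro sum.remove) auto
  also have "\<dots> = h ?k + (?g' c + (\<Sum>w\<in>C - {c}. ?g' w))" using g_c g_w by simp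
  also have "?g' c + (\<Sum>w\<in>C - {c}. ?g' w) = (\<Sum>w\<in>C. ?g' w)"
    using finC uc by (intro sum.remove[symmetric]) auto
  finally show ?thesis by (simp add: component_sum_def)
qed

lemma component_sum_rec:
  assumes A: "subtree A" and u: "u \<in> A"
  shows "component_sum h A u k = (\<Sum>C\<in>graph_components E (A - {u}). h (card C) +
    (\<Sum>w\<in>C. \<Sum>D\<in>graph_components E (A - {w}). h (card D + (if u \<in> D then k else 0))))"
proof -
  let ?g = "\<lambda>w. \<Sum>D\<in>graph_components E (A - {w}). h (card D + (if u \<in> D then k else 0))"
  have finA: "finite A" using A by (simp add: subtree_def)
  have "component_sum h A u k = ?g u + (\<Sum>w\<in>A - {u}. ?g w)"
    unfolding component_sum_def using finA u by (rule sum.remove)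
  also have "?g u = (\<Sum>C\<in>graph_components E (A - {u}). h (card C))"
  proof (intro sum.cong refl)
    fix D assume "D \<in> graph_components E (A - {u})"
    then have "u \<notin> D" using graph_components_subset[of D E "A - {u}"] by blast
    then show "h (card D + (if u \<in> D then k else 0)) = h (card D)" by simp
  qed
  also have "(\<Sum>w\<in>A - {u}. ?g w) = (\<Sum>C\<in>graph_components E (A - {u}). \<Sum>w\<in>C. ?g w)"
    using finA by (intro sum_components) simp
  finally show ?thesis by (simp add: sum.distrib)
qed

end

lemma subadditive_sum:
  fixes b :: "nat \<Rightarrow> real"
  assumes "finite I" "b 0 = 0" "\<And>x y. x + y < n \<Longrightarrow> b (x + y) \<le> b x + b y"
    and "(\<Sum>i\<in>I. s i) < n"
  shows "b (\<Sum>i\<in>I. s i) \<le> (\<Sum>i\<in>I. b (s i))"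
  using assms(1,4)
proof (induction I rule: finite_induct)
  case empty
  then show ?case using assms(2) by simp
next
  case (insert i I)
  have "b (s i + (\<Sum>i\<in>I. s i)) \<le> b (s i) + b (\<Sum>i\<in>I. s i)"
    using insert by (intro assms(3)) simp
  also have "\<dots> \<le> b (s i) + (\<Sum>i\<in>I. b (s i))" using insert by simp
  finally show ?case using insert by simp
qed

text \<open>
  An edge that cuts off \<open>s\<close> of the \<open>n\<close> vertices contributes \<open>h s + h (n - s)\<close>. The value \<open>b s\<close>
  bounds the contributions of all edges inside a branch of size \<open>s\<close> and of the edge above it:
  the hypothesis \<open>step\<close> accounts for the edge above the branch, and subadditivity allows
  the \<open>s - 1\<close> vertices below its root to be distributed over several smaller branches.
\<close>

lemma (in acyclic_graph) component_sum_lower_bound: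
  fixes b h :: "nat \<Rightarrow> real"
  assumes b0: "b 0 = 0"
    and subadd: "\<And>x y. x + y < n \<Longrightarrow> b (x + y) \<le> b x + b y"
    and step: "\<And>s. 0 < s \<Longrightarrow> s < n \<Longrightarrow> b s \<le> h s + h (n - s) + b (s - 1)"
    and "subtree A" "u \<in> A" "card A + k = n"
  shows "b (card A - 1) \<le> component_sum h A u k"
  using assms(4-6)
proof (induction "card A" arbitrary: A u k rule: less_induct)
  case less
  have finA: "finite A" using less.prems by (simp add: subtree_def)
  let ?\<C> = "graph_components E (A - {u})"
  have cardA: "card A > 0" using finA less.prems by (auto simp: card_gt_0_iff)
  have size: "(\<Sum>C\<in>?\<C>. card C) = card A - 1"
    using sum_card_components[of "A - {u}" E] finA less.prems by simp
  have "b (card A - 1) \<le> (\<Sum>C\<in>?\<C>. b (card C))"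
    unfolding size[symmetric]
    using finA less.prems cardA size
    by (intro subadditive_sum[OF _ b0 subadd]) (auto simp: finite_graph_components)
  also have "\<dots> \<le> (\<Sum>C\<in>?\<C>. h (card C) +
      (\<Sum>w\<in>C. \<Sum>D\<in>graph_components E (A - {w}). h (card D + (if u \<in> D then k else 0))))"
  proof (rule sum_mono)
    fix C assume C: "C \<in> ?\<C>"
    then obtain c where br: "branch A u C c" using branch_exists less.prems by metis
    have sub: "C \<subset> A" using branch_subset[OF br] less.prems by blast
    have lt: "card C < card A" using finA sub by (rule psubset_card_mono)
    have tC: "subtree C" using finite_Diff[OF finA] C by (rule component_subtree)
    have pos: "card C > 0" using tC by (simp add: subtree_def card_gt_0_iff)
    have k: "card A - card C + k = n - card C" using lt less.prems by simp
    have "b (card C - 1) \<le> component_sum h C c (n - card C)"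
      using lt less.prems tC br by (intro less.hyps) (auto simp: branch_def)
    moreover have "b (card C) \<le> h (card C) + h (n - card C) + b (card C - 1)"
      using pos lt less.prems by (intro step) auto
    ultimately show "b (card C) \<le> h (card C) +
      (\<Sum>w\<in>C. \<Sum>D\<in>graph_components E (A - {w}). h (card D + (if u \<in> D then k else 0)))"
      unfolding component_sum_branch[OF br] k by simp
  qed
  also have "\<dots> = component_sum h A u k"
    using component_sum_rec[OF less.prems(1,2)] by simp
  finally show ?case .
qed

section \<open>The excess over nine sixteenths\<close>

text \<open>
  For \<open>2 \<le> m \<le> 5\<close> the smallest value of \<open>16 q\<close> on \<open>m - 1\<close> vertices is exactly
  \<open>9 (m - 1) - 5 + excess m\<close>; for instance \<open>q = 1\<close> on two vertices and \<open>q = 2\<close> on the path with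
  four. The value at \<open>1\<close> expresses \<open>p = 1\<close> on a single vertex. The value \<open>1\<close> at \<open>5\<close>
  matters for the tree with seven vertices consisting of three paths of length two with a
  common end: with \<open>0\<close> in its place, the induction step fails there.
\<close>

definition excess :: "nat \<Rightarrow> real" where
  "excess m = (if m = 1 then 5 else if m = 2 then - 4 else if m = 3 then 3
     else if m = 4 then - 2 / 3 else if m = 5 then 1 else 0)"

text \<open>
  Up to the linear parts, these are the conditions of \<open>component_sum_lower_bound\<close>, together
  with the value at \<open>n - 1\<close> that the bound on \<open>q\<close> requires.
\<close>

definition edge_bound :: "nat \<Rightarrow> (nat \<Rightarrow> real) \<Rightarrow> bool" where
  "edge_bound n b \<longleftrightarrow> b 0 = 0 \<and> (\<forall>x y. x + y < n \<longrightarrow> b (x + y) \<le> b x + b y) \<and>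
     (\<forall>s. 0 < s \<longrightarrow> s < n \<longrightarrow> b s \<le> excess s + excess (n - s) + b (s - 1)) \<and>
     4 + real n * excess (n + 1) \<le> b (n - 1)"

text \<open>
  A solution of the constraints of \<open>edge_bound\<close> for \<open>8 \<le> n\<close>. The initial values add up the
  excesses along a pendant path: \<open>5\<close>, \<open>5 - 4\<close>, \<open>5 - 4 + 3\<close>. At \<open>4\<close>, subadditivity allows
  at most the contribution \<open>1 + 1\<close> of two branches of size \<open>2\<close>, and the middle sizes, whose
  edges have no negative excess, keep this value. The last four values
  reflect the excesses \<open>- 2 / 3\<close>, \<open>3\<close>, \<open>- 4\<close> and \<open>5\<close> of a small far side: \<open>2 - 2 / 3\<close>, then \<open>3\<close>
  because of the partition into sizes \<open>2\<close> and \<open>n - 5\<close>, then \<open>3 - 4\<close> and \<open>- 1 + 5\<close>, which is the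
  required value at \<open>n - 1\<close>.
\<close>

definition large_bound :: "nat \<Rightarrow> nat \<Rightarrow> real" where
  "large_bound n s = (if s = 0 then 0 else if s = 1 then 5 else if s = 2 then 1
     else if s = 3 then 4 else if s + 4 = n then 4 / 3 else if s + 3 = n then 3
     else if s + 2 = n then - 1 else if s + 1 = n then 4 else 2)"

lemma large_bound_values:
  shows "- 1 \<le> large_bound n s"
    and "s + 2 \<noteq> n \<Longrightarrow> 0 \<le> large_bound n s"
    and "s \<noteq> 1 \<Longrightarrow> large_bound n s \<le> 4"
    and "4 \<le> s \<Longrightarrow> s + 4 < n \<Longrightarrow> large_bound n s = 2"
  by (simp_all add: large_bound_def)

lemma large_bound_add_2:
  assumes "2 \<le> y" "y + 2 < n" "8 \<le> n"
  shows "large_bound n (y + 2) \<le> 1 + large_bound n y"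
proof -
  consider "n = y + 3" | "n = y + 4" | "n = y + 5" | "n = y + 6" | "y + 6 < n"
    using assms by linarith
  then show ?thesis
    using assms by cases (simp_all add: large_bound_def)
qed

lemma edge_bound_large:
  assumes "8 \<le> n"
  shows "edge_bound n (large_bound n)"
  unfolding edge_bound_def
proof (intro conjI allI impI)
  show "large_bound n 0 = 0" by (simp add: large_bound_def)
  show "large_bound n (x + y) \<le> large_bound n x + large_bound n y" if "x + y < n" for x y
    using that
  proof (induction x y rule: linorder_wlog)
    case (le x y)
    consider "x = 0" | "x = 1" | "x = 2" | "x = 3" | "4 \<le> x" by linarith
    then show ?case
    proof cases
      case 1
      then show ?thesis by (simp add: large_bound_def)
    next
      case 2
      have "y \<noteq> 0" using le 2 by simp
      then show ?thesis
        using large_bound_values(3)[of "y + 1" n] large_bound_values(1)[of n y] 2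
        by (simp add: large_bound_def[of n "Suc 0"])
    next
      case 3
      then show ?thesis
        using large_bound_add_2[of y n] le assms by (simp add: large_bound_def[of n 2])
    next
      case 4
      then have "y + 2 \<noteq> n" using le by simp
      then show ?thesis
        using large_bound_values(3)[of "y + 3" n] large_bound_values(2)[of y n] 4
        by (simp add: large_bound_def[of n 3] add.commute)
    next
      case 5
      then have "large_bound n x = 2" "large_bound n y = 2"
        using le by (auto intro!: large_bound_values(4))
      then show ?thesis using large_bound_values(3)[of "x + y" n] 5 by simp
    qed
  next
    case (sym x y)
    then show ?case by (simp add: add.commute)
  qed
  show "large_bound n s \<le> excess s + excess (n - s) + large_bound n (s - 1)"
    if s: "0 < s" "s < n" for s
  proof -
    have ex: "0 \<le> excess m" if "5 \<le> m" for m using that by (simp add: excess_def)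
    consider "s = 1" | "s = 2" | "s = 3" | "s = 4" "n = 8" | "s = 4" "8 < n"
      | "5 \<le> s" "n - s \<le> 4" | "5 \<le> s" "5 \<le> n - s"
      using s assms by linarith
    then show ?thesis
    proof cases
      case 1
      then show ?thesis using ex[of "n - 1"] assms by (simp add: large_bound_def excess_def[of "Suc 0"])
    next
      case 2
      then show ?thesis using ex[of "n - 2"] assms by (simp add: large_bound_def excess_def[of 2])
    next
      case 3
      then show ?thesis using ex[of "n - 3"] assms by (simp add: large_bound_def excess_def[of 3])
    next
      case 4
      then show ?thesis by (simp add: large_bound_def excess_def)
    next
      case 5
      then have "excess (n - 4) \<ge> 0" "large_bound n 4 = 2"
        by (simp_all add: ex large_bound_values(4))
      then show ?thesis using 5 by (simp add: large_bound_def[of n 3] excess_def[of 4])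
    next
      case 6
      obtain m where m: "s = m + 5" using 6 by (metis add.commute le_Suc_ex)
      have "n = s + 1 \<or> n = s + 2 \<or> n = s + 3 \<or> n = s + 4" using 6 s by linarith
      then show ?thesis
        using ex[OF 6(1)] unfolding m
        by (elim disjE) (simp_all add: large_bound_def excess_def[of "Suc 0"] excess_def[of 2]
            excess_def[of 3] excess_def[of 4])
    next
      case 7
      then have "large_bound n s = 2" "large_bound n (s - 1) = 2"
        by (auto intro!: large_bound_values(4))
      then show ?thesis using ex[OF 7(1)] ex[OF 7(2)] by simp
    qed
  qed
  show "4 + real n * excess (n + 1) \<le> large_bound n (n - 1)"
  proof -
    obtain m where "n = m + 8" using assms by (metis add.commute le_Suc_ex)
    then show ?thesis by (simp add: large_bound_def excess_def)
  qed
qed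

text \<open>
  For small \<open>n\<close> both sides of an edge can be small, so the general pattern does not apply. The
  lists below are the greatest solutions: the entry at \<open>s\<close> is the minimum of
  \<open>excess s + excess (n - s) + b (s - 1)\<close> and of all \<open>b x + b y\<close> with \<open>x + y = s\<close> and \<open>0 < x, y\<close>.
\<close>

lemma edge_bound_exists:
  assumes "0 < n"
  obtains b where "edge_bound n b"
proof -
  have small: "edge_bound n ((!) bs)" if "n = length bs" "n \<le> 7" "bs ! 0 = 0"
    "\<forall>y<n. \<forall>x<n - y. bs ! (x + y) \<le> bs ! x + bs ! y"
    "\<forall>s<n. 0 < s \<longrightarrow> bs ! s \<le> excess s + excess (n - s) + bs ! (s - 1)"
    "4 + real n * excess (n + 1) \<le> bs ! (n - 1)" for bs
    using that by (auto simp: edge_bound_def)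
  consider "n = 1" | "n = 2" | "n = 3" | "n = 4" | "n = 5" | "n = 6" | "n = 7" | "8 \<le> n"
    using assms by linarith
  then show ?thesis
  proof cases
    case 1
    show ?thesis by (rule that, rule small[of "[0]"])
        (simp_all add: 1 excess_def eval_nat_numeral All_less_Suc)
  next
    case 2
    show ?thesis by (rule that, rule small[of "[0, 10]"])
        (simp_all add: 2 excess_def eval_nat_numeral All_less_Suc)
  next
    case 3
    show ?thesis by (rule that, rule small[of "[0, 1, 2]"])
        (simp_all add: 3 excess_def eval_nat_numeral All_less_Suc)
  next
    case 4
    show ?thesis by (rule that, rule small[of "[0, 8, 0, 8]"])
        (simp_all add: 4 excess_def eval_nat_numeral All_less_Suc)
  next
    case 5
    show ?thesis by (rule that, rule small[of "[0, 13/3, 10/3, 7/3, 20/3]"])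
        (simp_all add: 5 excess_def eval_nat_numeral All_less_Suc)
  next
    case 6
    show ?thesis by (rule that, rule small[of "[0, 6, 4/3, 22/3, 8/3, 26/3]"])
        (simp_all add: 6 excess_def eval_nat_numeral All_less_Suc)
  next
    case 7
    show ?thesis by (rule that, rule small[of "[0, 5, 2, 13/3, 4, 1, 6]"])
        (simp_all add: 7 excess_def eval_nat_numeral All_less_Suc)
  next
    case 8
    then show ?thesis using edge_bound_large that by blast
  qed
qed

section \<open>Bounds for all subtrees\<close>

context acyclic_graph
begin

lemma second_player_step:
  assumes A: "subtree A"
    and p: "\<And>C. subtree C \<Longrightarrow> card C < card A \<Longrightarrow>
      9 * real (card C) + 2 + excess (card C) \<le> 16 * opt_sum E True C"
  shows "9 * real (card A) - 5 + excess (card A + 1) \<le> 16 * opt_sum E False A"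
proof -
  define n where "n = card A"
  have finA: "finite A" using A by (simp add: subtree_def)
  have n: "0 < n" using A by (auto simp: n_def subtree_def card_gt_0_iff)
  obtain u where u: "u \<in> A" using A by (auto simp: subtree_def)
  obtain b where b: "edge_bound n b" using edge_bound_exists[OF n] .
  define h where "h = (\<lambda>s. 9 * real s + 2 + excess s)"
  \<comment> \<open>There are \<open>n - 1\<close> edges, and the linear part of \<open>h s + h (n - s)\<close> is \<open>9 n + 4\<close> for each.\<close>
  define b' where "b' = (\<lambda>s. b s + (9 * real n + 4) * real s)"
  \<comment> \<open>The whole tree counts as a branch with nothing on the far side of its root.\<close>
  have "b' (card A - 1) \<le> component_sum h A u 0"
  proof (rule component_sum_lower_bound[where n = n])
    show "b' 0 = 0" using b by (simp add: b'_def edge_bound_def)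
    show "b' (x + y) \<le> b' x + b' y" if "x + y < n" for x y
      using b that by (auto simp: b'_def edge_bound_def algebra_simps)
    show "b' s \<le> h s + h (n - s) + b' (s - 1)" if "0 < s" "s < n" for s
    proof -
      have "b s \<le> excess s + excess (n - s) + b (s - 1)"
        using b that by (simp add: edge_bound_def)
      then show ?thesis using that by (simp add: b'_def h_def of_nat_diff algebra_simps)
    qed
  qed (use A u n_def in simp_all)
  moreover have "9 * real n * real n - 5 * real n + real n * excess (n + 1) \<le> b' (n - 1)"
  proof -
    have "4 + real n * excess (n + 1) \<le> b (n - 1)" using b by (simp add: edge_bound_def)
    then show ?thesis using n by (simp add: b'_def of_nat_diff algebra_simps)
  qed
  moreover have "component_sum h A u 0 \<le> 16 * (\<Sum>v\<in>A. \<Sum>C\<in>graph_components E (A - {v}). opt_sum E True C)"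
  proof -
    have "h (card C) \<le> 16 * opt_sum E True C" if v: "v \<in> A" and C: "C \<in> graph_components E (A - {v})" for v C
    proof -
      have "C \<subset> A" using v graph_components_subset[OF C] by blast
      then have "card C < card A" using finA by (rule psubset_card_mono[rotated])
      moreover have "subtree C" using finite_Diff[OF finA] C by (rule component_subtree)
      ultimately show ?thesis unfolding h_def by (intro p)
    qed
    then show ?thesis
      unfolding component_sum_def sum_distrib_left by (intro sum_mono) auto
  qed
  moreover have "(\<Sum>v\<in>A. \<Sum>C\<in>graph_components E (A - {v}). opt_sum E True C) = real n * opt_sum E False A"
    using finA n by (subst opt_sum.simps) (simp add: n_def)
  ultimately have "real n * (9 * real n - 5 + excess (n + 1)) \<le> real n * (16 * opt_sum E False A)"
    by (simp add: n_def algebra_simps)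
  then show ?thesis using n by (simp add: n_def)
qed

lemma first_player_step:
  assumes A: "subtree A"
    and q: "\<And>C. subtree C \<Longrightarrow> card C < card A \<Longrightarrow>
      9 * real (card C) - 5 + excess (card C + 1) \<le> 16 * opt_sum E False C"
  shows "9 * real (card A) + 2 + excess (card A) \<le> 16 * opt_sum E True A"
proof -
  have finA: "finite A" using A by (simp add: subtree_def)
  have pos: "0 < card A" using A by (auto simp: subtree_def card_gt_0_iff)
  have guess: "1 + (\<Sum>C\<in>graph_components E (A - {v}). opt_sum E False C) \<le> opt_sum E True A"
    if "v \<in> A" for v
    using finA that by (subst (2) opt_sum.simps) (auto intro!: Max_ge)
  show ?thesis
  proof (cases "card A = 1")
    case True
    then obtain v where "A = {v}" by (auto simp: card_1_singleton_iff)
    then have "1 \<le> opt_sum E True A" using guess[of v] by (simp add: graph_components_def)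
    then show ?thesis using True by (simp add: excess_def)
  next
    case False
    then have "2 \<le> card A" using pos by linarith
    then obtain v where v: "v \<in> A" "graph_components E (A - {v}) = {A - {v}}"
      using leaf_exists[OF A] by blast
    then have tree: "subtree (A - {v})" using finA component_subtree[of "A - {v}"] by simp
    have card: "card (A - {v}) = card A - 1" using v finA by simp
    have "9 * real (card A - 1) - 5 + excess (card A - 1 + 1) \<le> 16 * opt_sum E False (A - {v})"
      using q[OF tree] pos unfolding card by simp
    moreover have "1 + opt_sum E False (A - {v}) \<le> opt_sum E True A" using guess[OF v(1)] v(2) by simp
    ultimately show ?thesis using pos by (simp add: of_nat_diff algebra_simps)
  qed
qed

lemma subtree_bounds:
  assumes "subtree A"
  shows "9 * real (card A) + 2 + excess (card A) \<le> 16 * opt_sum E True A \<and>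
    9 * real (card A) - 5 + excess (card A + 1) \<le> 16 * opt_sum E False A"
  using assms
proof (induction "card A" arbitrary: A rule: less_induct)
  case less
  then show ?case using first_player_step[of A] second_player_step[of A] by blast
qed

end

section \<open>The winning probabilities\<close>

theorem theorem4p12:
  fixes V :: "'a set" and E :: "'a set set" and n :: nat
  assumes "tree V E" and "card V = n" and "n \<ge> 4"
  shows "P_first V E > 9 / 16 \<and> Q_second V E \<ge> 9 / 16 - 5 / (16 * real n)"
proof -
  interpret acyclic_graph E
    using assms(1) by unfold_locales (simp add: tree_def)
  have V: "finite V" "V \<noteq> {}" "subtree V" using assms(1) by (auto simp: tree_def subtree_def)
  have ex: "- 2 / 3 \<le> excess n" "0 \<le> excess (n + 1)" using assms(3) by (auto simp: excess_def)
  have n: "0 < real n" using assms(3) by simp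
  have "9 * real n < 16 * (real n * P_first V E)"
    using subtree_bounds[OF V(3)] ex opt_sum_eq(1)[OF V(1,2), of E] assms(2) by simp
  then have "real n * 9 < real n * (16 * P_first V E)" by simp
  then have P: "9 < 16 * P_first V E" using n by (simp only: mult_less_cancel_left_pos)
  have "9 * real n - 5 \<le> 16 * (real n * Q_second V E)"
    using subtree_bounds[OF V(3)] ex opt_sum_eq(2)[OF V(1,2), of E] assms(2) by simp
  then have "9 / 16 - 5 / (16 * real n) \<le> Q_second V E" using n by (simp add: field_simps)
  then show ?thesis using P by simp
qed

end
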